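(* Let $0\le a\le b$ be integers. Suppose the game is Imitation Nim. Then $(a,b)$ is (i) non-dynamic $P$ if and only if it is a $P$-position of Wythoff Nim; (ii) non-dynamic $N$ if and only if (a) there are integers $0\le c\le d<b$ with $b-a=d-c$ such that $(c,d)$ is a $P$-position of Wythoff Nim, or (b) there is an integer $0\le c<a$ such that $(a,c)$ is a $P$-position of Wythoff Nim.
   Context: Positions are pairs $(a,b)$ of non-negative integers, the heights of two piles of tokens. Two players alternate; a player unable to move loses (normal play). All games are symmetric: $(a,b)$ and $(b,a)$ have the same status. **Imitation Nim.** A move removes a positive number of tokens from exactly one pile (2-pile Nim), except that a player may not imitate the previous player's move. Here, let $A$ and $B$ be the two piles with $\#A\le\#B$, the tokens being counted before the previous player's removal (if the heights are equal, either pile may play the role of $A$); if the previous player removed $x$ tokens from pile $A$, the next player imitates if he removes exactly $x$ tokens from pile $B$. No other move is an imitation; the first move of the game is never an imitation. Whether a position of Imitation Nim is $P$ (the previous player, i.e. the one not about to move, wins given best play) or $N$ (the player about to move wins given best play) may depend on the history of play (the starting position and the moves made so far; the history may be empty, the position being the starting position). A position is *non-dynamic $P$* if it is $P$ regardless of any previous (legal) move(s), *non-dynamic $N$* if it is $N$ regardless of any previous (legal) move(s), and *dynamic* otherwise. **Wythoff Nim.** A move removes either a positive number of tokens from exactly one pile, or the same positive number of tokens from both piles. A $P$-position of Wythoff Nim is one from which the previous player wins given best play; equivalently, with $\phi=\frac{1+\sqrt5}{2}$, $(x,y)$ with $x\le y$ is a $P$-position if and only if $(x,y)=(\lfloor n\phi\rfloor,\lfloor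 n\phi^2\rfloor)$ for some integer $n\ge 0$. *)

theory Defs
  imports Main
begin

text \<open>Normal play on an arbitrary move relation: the player about to move wins if he can
  move to a state from which the previous player wins; the previous player wins if every
  move leads to a state from which the (new) player about to move wins, in particular if there
  is no move at all.\<close>

inductive next_wins :: "('s \<Rightarrow> 's \<Rightarrow> bool) \<Rightarrow> 's \<Rightarrow> bool"
  and prev_wins :: "('s \<Rightarrow> 's \<Rightarrow> bool) \<Rightarrow> 's \<Rightarrow> bool"
  for mv :: "'s \<Rightarrow> 's \<Rightarrow> bool"
where
  next_winsI: "mv s t \<Longrightarrow> prev_wins mv t \<Longrightarrow> next_wins mv s"
| prev_winsI: "(\<And>t. mv s t \<Longrightarrow> next_wins mv t) \<Longrightarrow> prev_wins mv s"

type_synonym position = "nat \<times> nat"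

subsection \<open>Wythoff Nim\<close>

inductive wythoff_move :: "position \<Rightarrow> position \<Rightarrow> bool" where
  "0 < x \<Longrightarrow> x \<le> a \<Longrightarrow> wythoff_move (a, b) (a - x, b)"
| "0 < x \<Longrightarrow> x \<le> b \<Longrightarrow> wythoff_move (a, b) (a, b - x)"
| "0 < x \<Longrightarrow> x \<le> a \<Longrightarrow> x \<le> b \<Longrightarrow> wythoff_move (a, b) (a - x, b - x)"

definition wythoff_P :: "position \<Rightarrow> bool" where
  "wythoff_P p \<longleftrightarrow> prev_wins wythoff_move p"

subsection \<open>Imitation Nim\<close>

datatype pile = First | Second

fun height :: "pile \<Rightarrow> position \<Rightarrow> nat" where
  "height First (a, b) = a"
| "height Second (a, b) = b"

type_synonym nim_move = "pile \<times> nat"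

fun remove_tokens :: "nim_move \<Rightarrow> position \<Rightarrow> position" where
  "remove_tokens (First, x) (a, b) = (a - x, b)"
| "remove_tokens (Second, x) (a, b) = (a, b - x)"

datatype history = Start position | After history nim_move

fun current :: "history \<Rightarrow> position" where
  "current (Start p) = p"
| "current (After h m) = remove_tokens m (current h)"

text \<open>The heights are compared before the previous player's removal, i.e. in
  \<^term>\<open>current h\<close>. If they are equal, the pile the previous player took from counts as the
  smaller one.\<close>

fun imitates :: "history \<Rightarrow> nim_move \<Rightarrow> bool" where
  "imitates (Start p) m \<longleftrightarrow> False"
| "imitates (After h (i, x)) (j, y) \<longleftrightarrow>
     height i (current h) \<le> height j (current h) \<and> j \<noteq> i \<and> y = x"

fun legal_move :: "history \<Rightarrow> nim_move \<Rightarrow> bool" where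
  "legal_move h (i, x) \<longleftrightarrow> 0 < x \<and> x \<le> height i (current h) \<and> \<not> imitates h (i, x)"

inductive legal_history :: "history \<Rightarrow> bool" where
  "legal_history (Start p)"
| "legal_history h \<Longrightarrow> legal_move h m \<Longrightarrow> legal_history (After h m)"

definition imitation_move :: "history \<Rightarrow> history \<Rightarrow> bool" where
  "imitation_move h h' \<longleftrightarrow> (\<exists>m. legal_move h m \<and> h' = After h m)"

definition nondynamic_P :: "position \<Rightarrow> bool" where
  "nondynamic_P p \<longleftrightarrow>
     (\<forall>h. legal_history h \<and> current h = p \<longrightarrow> prev_wins imitation_move h)"

definition nondynamic_N :: "position \<Rightarrow> bool" where
  "nondynamic_N p \<longleftrightarrow>
     (\<forall>h. legal_history h \<and> current h = p \<longrightarrow> next_wins imitation_move h)"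

end

theory Submission imports Defs
begin

text \<open>Call a history of Imitation Nim good if its current position is a \<open>P\<close>-position of Wythoff
  Nim, or if the one removal that is now banned as an imitation would have reached such a position.
  The good histories are exactly those from which the previous player wins
  (\<open>prev_wins_imitation_iff_good\<close>). The idea is that a player who cannot take \<open>t\<close> tokens from both
  piles may simulate this: he takes \<open>t\<close> from the smaller pile, and the imitation rule then keeps
  his opponent from completing the diagonal move himself. So from every history that is not good a
  good one can be reached: if the winning Wythoff move takes tokens from one pile, it is available,
  and if it takes tokens from both piles, it is simulated.

  Conversely, no move leads from a good history to a good one. When the current position is a
  Wythoff \<open>P\<close>-position, this holds because two such positions never lie on a common row, column or
  diagonal. When only the banned removal reaches a Wythoff \<open>P\<close>-position, one also needs that the
  \<open>P\<close>-positions \<open>(c, d)\<close> with \<open>c \<le> d\<close> are ordered by their difference \<open>d - c\<close> in the same way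
  as by \<open>c\<close> (\<open>wythoff_P_difference_mono\<close>). This monotonicity, and the fact that every difference
  below that of a \<open>P\<close>-position occurs at an earlier \<open>P\<close>-position
  (\<open>smaller_difference_occurs\<close>), follow from the rules of Wythoff Nim, without the
  formula with the golden ratio.

  A position is therefore dynamic if and only if it is not a Wythoff \<open>P\<close>-position but some removal
  that can be banned reaches one. The removals that can be banned are those from the larger pile
  after which it is still at least as high as the other one. The cases in the theorem
  are the remaining ways in which a Wythoff move can reach a \<open>P\<close>-position; a winning removal from
  the smaller pile does not appear there because it forces a winning diagonal move to exist.\<close>

section \<open>Games that terminate\<close>

lemma next_wins_not_prev_wins:
  "next_wins mv s \<Longrightarrow> \<not> prev_wins mv s"
  "prev_wins mv s \<Longrightarrow> \<not> next_wins mv s"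
proof (induction rule: next_wins_prev_wins.inducts)
  case (next_winsI s t)
  then show ?case by (auto elim: prev_wins.cases)
next
  case (prev_winsI s)
  then show ?case by (auto elim: next_wins.cases)
qed

lemma next_wins_or_prev_wins:
  fixes f :: "'s \<Rightarrow> nat"
  assumes decreasing: "\<And>s t. mv s t \<Longrightarrow> f t < f s"
  shows "next_wins mv s \<or> prev_wins mv s"
proof (induction "f s" arbitrary: s rule: less_induct)
  case less
  then show ?case
    using decreasing by (metis next_winsI prev_winsI)
qed

lemma next_wins_iff_not_prev_wins:
  fixes f :: "'s \<Rightarrow> nat"
  assumes "\<And>s t. mv s t \<Longrightarrow> f t < f s"
  shows "next_wins mv s \<longleftrightarrow> \<not> prev_wins mv s"
  using next_wins_or_prev_wins[of mv f, OF assms] next_wins_not_prev_wins by metis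

lemma prev_wins_iff:
  fixes f :: "'s \<Rightarrow> nat"
  assumes "\<And>s t. mv s t \<Longrightarrow> f t < f s"
  shows "prev_wins mv s \<longleftrightarrow> (\<forall>t. mv s t \<longrightarrow> \<not> prev_wins mv t)"
proof -
  have "prev_wins mv s \<longleftrightarrow> (\<forall>t. mv s t \<longrightarrow> next_wins mv t)"
    by (auto intro: prev_winsI elim: prev_wins.cases)
  then show ?thesis
    using next_wins_iff_not_prev_wins[of mv f, OF assms] by simp
qed

text \<open>A terminating game has only one kernel. The invariant \<open>I\<close> allows the kernel to be described
  on the reachable states only.\<close>

lemma prev_wins_iff_kernel:
  fixes f :: "'s \<Rightarrow> nat"
  assumes decreasing: "\<And>s t. mv s t \<Longrightarrow> f t < f s"
    and invariant: "\<And>s t. I s \<Longrightarrow> mv s t \<Longrightarrow> I t"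
    and stable: "\<And>s t. I s \<Longrightarrow> Q s \<Longrightarrow> mv s t \<Longrightarrow> \<not> Q t"
    and absorbing: "\<And>s. I s \<Longrightarrow> \<not> Q s \<Longrightarrow> \<exists>t. mv s t \<and> Q t"
    and "I s"
  shows "prev_wins mv s \<longleftrightarrow> Q s"
  using \<open>I s\<close>
proof (induction "f s" arbitrary: s rule: less_induct)
  case less
  have "prev_wins mv t \<longleftrightarrow> Q t" if "mv s t" for t
    using less that decreasing invariant by blast
  then show ?case
    using prev_wins_iff[of mv f, OF decreasing] stable absorbing less.prems by metis
qed

section \<open>The \<open>P\<close>-positions of Wythoff Nim\<close>

lemma wythoff_P_iff:
  "wythoff_P (a, b) \<longleftrightarrow>
     \<not> (\<exists>t. 0 < t \<and> (t \<le> a \<and> wythoff_P (a - t, b) \<or> t \<le> b \<and> wythoff_P (a, b - t) \<or>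
                   t \<le> a \<and> t \<le> b \<and> wythoff_P (a - t, b - t)))"
proof -
  have decreasing: "fst q + snd q < fst p + snd p" if "wythoff_move p q" for p q :: position
    using that by cases auto
  have options: "wythoff_move (a, b) q \<longleftrightarrow>
      (\<exists>t. 0 < t \<and> (t \<le> a \<and> q = (a - t, b) \<or> t \<le> b \<and> q = (a, b - t) \<or>
                    t \<le> a \<and> t \<le> b \<and> q = (a - t, b - t)))" for q
    by (subst wythoff_move.simps) blast
  have "wythoff_P (a, b) \<longleftrightarrow> (\<forall>q. wythoff_move (a, b) q \<longrightarrow> \<not> wythoff_P q)"
    unfolding wythoff_P_def
    by (rule prev_wins_iff[where f = "\<lambda>p. fst p + snd p", OF decreasing])
  also have "(\<forall>q. wythoff_move (a, b) q \<longrightarrow> \<not> wythoff_P q) \<longleftrightarrow>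
     \<not> (\<exists>t. 0 < t \<and> (t \<le> a \<and> wythoff_P (a - t, b) \<or> t \<le> b \<and> wythoff_P (a, b - t) \<or>
                   t \<le> a \<and> t \<le> b \<and> wythoff_P (a - t, b - t)))"
    unfolding options by blast
  finally show ?thesis .
qed

lemma wythoff_P_swap: "wythoff_P (a, b) \<longleftrightarrow> wythoff_P (b, a)"
proof (induction "a + b" arbitrary: a b rule: less_induct)
  case less
  have
    "\<And>t. 0 < t \<Longrightarrow> t \<le> a \<Longrightarrow> wythoff_P (a - t, b) \<longleftrightarrow> wythoff_P (b, a - t)"
    "\<And>t. 0 < t \<Longrightarrow> t \<le> b \<Longrightarrow> wythoff_P (a, b - t) \<longleftrightarrow> wythoff_P (b - t, a)"
    "\<And>t. 0 < t \<Longrightarrow> t \<le> a \<Longrightarrow> t \<le> b \<Longrightarrow> wythoff_P (a - t, b - t) \<longleftrightarrow> wythoff_P (b - t, a - t)"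
    by (rule less; simp)+
  then show ?case
    unfolding wythoff_P_iff[of a b] wythoff_P_iff[of b a]
    by (intro arg_cong[where f = Not] ex_cong1 conj_cong refl) blast
qed

lemma wythoff_P_row_unique:
  assumes "wythoff_P (a, b)" "wythoff_P (a, b')"
  shows "b = b'"
proof -
  have False if "wythoff_P (a, d)" "wythoff_P (a, d')" "d' < d" for d d'
    using that wythoff_P_iff[of a d]
    by (metis diff_diff_cancel diff_le_self less_imp_le zero_less_diff)
  then show ?thesis
    using assms by (metis linorder_neqE_nat)
qed

lemma wythoff_P_diagonal_unique:
  assumes "wythoff_P (a, a + k)" "wythoff_P (c, c + k)"
  shows "a = c"
proof -
  have False if "wythoff_P (d, d + k)" "wythoff_P (d', d' + k)" "d' < d" for d d'
  proof -
    have "d - (d - d') = d'" "d + k - (d - d') = d' + k"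
      using that(3) by auto
    moreover have "0 < d - d'" "d - d' \<le> d" "d - d' \<le> d + k"
      using that(3) by auto
    ultimately show False
      using that wythoff_P_iff[of d "d + k"] by metis
  qed
  then show ?thesis
    using assms by (metis linorder_neqE_nat)
qed

text \<open>The position \<open>(c, c + k)\<close> lies in the same row as the \<open>P\<close>-position \<open>(c, b)\<close>, so it is not
  a \<open>P\<close>-position itself and has a move to one. This move changes the first pile, because the only
  \<open>P\<close>-position of the row has a larger second pile. Either it is a diagonal move, which
  keeps the difference \<open>k\<close>, or it leads to a \<open>P\<close>-position with a smaller first pile and a difference
  that is still above \<open>k\<close>, from which one can descend.\<close>

lemma smaller_difference_occurs:
  assumes "wythoff_P (c, b)" "c + k < b"
  shows "\<exists>c'<c. wythoff_P (c', c' + k)"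
  using assms
proof (induction c arbitrary: b rule: less_induct)
  case (less c)
  have "\<not> wythoff_P (c, c + k)"
    using less.prems wythoff_P_row_unique by blast
  then obtain t where t: "0 < t"
    and option: "t \<le> c \<and> wythoff_P (c - t, c + k) \<or>
      t \<le> c + k \<and> wythoff_P (c, c + k - t) \<or>
      t \<le> c \<and> t \<le> c + k \<and> wythoff_P (c - t, c + k - t)"
    using wythoff_P_iff[of c "c + k"] by blast
  have "\<not> wythoff_P (c, c + k - t)"
    using less.prems wythoff_P_row_unique[of c b "c + k - t"] by auto
  with option consider "t \<le> c" "wythoff_P (c - t, c + k)"
    | "t \<le> c" "wythoff_P (c - t, c + k - t)"
    by blast
  then show ?case
  proof cases
    case 1
    then have "\<exists>c'<c - t. wythoff_P (c', c' + k)"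
      using less.IH[of "c - t" "c + k"] t by simp
    then show ?thesis
      by (meson diff_le_self order_less_le_trans)
  next
    case 2
    then have "wythoff_P (c - t, c - t + k)" "c - t < c"
      using t by simp_all
    then show ?thesis
      by blast
  qed
qed

lemma wythoff_P_difference_mono:
  assumes "wythoff_P (a, a + k)" "wythoff_P (c, c + l)" "a < c"
  shows "k < l"
proof (rule ccontr)
  assume "\<not> k < l"
  then consider "k = l" | "l < k"
    by linarith
  then show False
  proof cases
    case 1
    then show False
      using assms wythoff_P_diagonal_unique by blast
  next
    case 2
    then obtain a' where "a' < a" "wythoff_P (a', a' + l)"
      using smaller_difference_occurs[OF assms(1), of l] by auto
    then show False
      using assms wythoff_P_diagonal_unique[of a' l c] by auto
  qed
qed

lemma wythoff_P_closer_below: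
  assumes "wythoff_P (c, d)" "wythoff_P (a, b)" "c < a" "c \<le> d" "a \<le> b" "b - a \<le> d - c"
  shows False
  using assms wythoff_P_difference_mono[of c "d - c" a "b - a"] by auto

section \<open>Winning histories of Imitation Nim\<close>

definition good :: "history \<Rightarrow> bool" where
  "good h \<longleftrightarrow> wythoff_P (current h) \<or>
     (\<exists>m. imitates h m \<and> wythoff_P (remove_tokens m (current h)))"

lemma height_remove_tokens [simp]:
  "height i (remove_tokens (i, x) p) = height i p - x"
  "j \<noteq> i \<Longrightarrow> height j (remove_tokens (i, x) p) = height j p"
  by (cases i; cases p; cases j; simp)+

lemma wythoff_P_heights:
  assumes "i \<noteq> j"
  shows "wythoff_P p \<longleftrightarrow> wythoff_P (height i p, height j p)"
  using assms by (cases i; cases j; cases p) (auto simp: wythoff_P_swap)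

text \<open>A banned removal of \<open>x\<close> tokens is from a pile that exceeds the other by at least \<open>x\<close>:
  the heights were already in this order before the previous player took \<open>x\<close> tokens.\<close>

lemma imitates_heights:
  assumes "legal_history h" "imitates h (j, x)" "i \<noteq> j"
  shows "0 < x" "height i (current h) + x \<le> height j (current h)"
proof -
  obtain h' i' where h: "h = After h' (i', x)"
    and i': "height i' (current h') \<le> height j (current h')" "j \<noteq> i'"
    using assms(2) by (cases h) auto
  have "legal_move h' (i', x)"
    using assms(1) h by (auto elim: legal_history.cases)
  moreover have "i' = i"
    using i'(2) assms(3) by (metis (full_types) pile.exhaust)
  ultimately show "0 < x" "height i (current h) + x \<le> height j (current h)"
    using h i' assms(3) by auto
qed

text \<open>After a removal from the lower pile, the banned reply would complete the diagonal Wythoff move;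
  after a removal from the strictly higher pile, nothing is banned.\<close>

lemma good_After_iff:
  assumes "i \<noteq> j"
  shows "good (After h (i, x)) \<longleftrightarrow>
     wythoff_P (height i (current h) - x, height j (current h)) \<or>
     height i (current h) \<le> height j (current h) \<and>
       wythoff_P (height i (current h) - x, height j (current h) - x)"
proof -
  have only_pile: "k \<noteq> i \<longleftrightarrow> k = j" for k
    using assms by (metis (full_types) pile.exhaust)
  show ?thesis
    using assms
      wythoff_P_heights[OF assms, of "remove_tokens (i, x) (current h)"]
      wythoff_P_heights[OF assms, of "remove_tokens (j, x) (remove_tokens (i, x) (current h))"]
    by (auto simp: good_def only_pile)
qed

lemma good_stable:
  assumes "legal_history h" "good h" "legal_move h (i, x)"
  shows "\<not> good (After h (i, x))"
proof -
  obtain j where ij: "i \<noteq> j"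
    by (metis pile.distinct(1))
  define u v where "u = height i (current h)" and "v = height j (current h)"
  have x: "0 < x" "x \<le> u" "\<not> imitates h (i, x)"
    using assms(3) by (auto simp: u_def)
  have "\<not> wythoff_P (u - x, v) \<and> \<not> (u \<le> v \<and> wythoff_P (u - x, v - x))"
  proof -
    from \<open>good h\<close> consider (position) "wythoff_P (u, v)"
      | (banned) k y where "imitates h (k, y)" "wythoff_P (remove_tokens (k, y) (current h))"
      using wythoff_P_heights[OF ij, of "current h"] by (auto simp: good_def u_def v_def)
    then show ?thesis
    proof cases
      case position
      then show ?thesis
        using x wythoff_P_iff[of u v] by (metis order_trans)
    next
      case banned
      from ij have "k = i \<or> k = j"
        by (metis (full_types) pile.exhaust)
      then show ?thesis
      proof
        assume k: "k = i"
        then have y: "0 < y" "v + y \<le> u"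
          using imitates_heights[OF assms(1), of i y j] banned ij by (auto simp: u_def v_def)
        have "wythoff_P (v, u - y)"
          using banned k ij wythoff_P_heights[of j i "remove_tokens (i, y) (current h)"]
          by (simp add: u_def v_def)
        moreover have "x \<noteq> y"
          using banned k x by blast
        ultimately have "\<not> wythoff_P (v, u - x)"
          using wythoff_P_row_unique[of v "u - y" "u - x"] x y by auto
        then show ?thesis
          using y by (auto simp: wythoff_P_swap)
      next
        assume k: "k = j"
        then have y: "0 < y" "u + y \<le> v"
          using imitates_heights[OF assms(1), of j y i] banned ij by (auto simp: u_def v_def)
        have P: "wythoff_P (u, v - y)"
          using banned k ij wythoff_P_heights[OF ij, of "remove_tokens (j, y) (current h)"]
          by (simp add: u_def v_def)
        have "u - x < u" "u - x \<le> v" "u - x \<le> v - x" "u \<le> v - y"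
          "(v - y) - u \<le> v - (u - x)" "(v - y) - u \<le> (v - x) - (u - x)"
          using x y by linarith+
        then show ?thesis
          using wythoff_P_closer_below[OF _ P] by blast
      qed
    qed
  qed
  then show ?thesis
    by (simp add: good_After_iff[OF ij] u_def v_def)
qed

text \<open>The simulated diagonal move is always legal since only removals from the strictly higher
  pile are ever banned.\<close>

lemma good_absorbing:
  assumes "legal_history h" "\<not> good h"
  shows "\<exists>m. legal_move h m \<and> good (After h m)"
proof -
  have single: "\<exists>m. legal_move h m \<and> good (After h m)"
    if "0 < t" "t \<le> height i (current h)" "wythoff_P (remove_tokens (i, t) (current h))" for i t
  proof -
    have "\<not> imitates h (i, t)"
      using assms(2) that(3) by (auto simp: good_def)
    then have "legal_move h (i, t)" "good (After h (i, t))"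
      using that by (auto simp: good_def)
    then show ?thesis
      by blast
  qed
  have diagonal: "\<exists>m. legal_move h m \<and> good (After h m)"
    if "i \<noteq> j" "0 < t" "t \<le> height i (current h)" "height i (current h) \<le> height j (current h)"
      "wythoff_P (height i (current h) - t, height j (current h) - t)" for i j t
  proof -
    have "\<not> imitates h (i, t)"
      using imitates_heights[OF assms(1), of i t j] that by auto
    then have "legal_move h (i, t)" "good (After h (i, t))"
      using that good_After_iff[OF that(1)] by auto
    then show ?thesis
      by blast
  qed
  obtain a b where p: "current h = (a, b)"
    by fastforce
  have "\<not> wythoff_P (a, b)"
    using assms(2) p by (simp add: good_def)
  then obtain t where "0 < t" and
    "t \<le> a \<and> wythoff_P (a - t, b) \<or> t \<le> b \<and> wythoff_P (a, b - t) \<or>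
     t \<le> a \<and> t \<le> b \<and> wythoff_P (a - t, b - t)"
    using wythoff_P_iff[of a b] by blast
  then consider "t \<le> a" "wythoff_P (a - t, b)" | "t \<le> b" "wythoff_P (a, b - t)"
    | "t \<le> a" "a \<le> b" "wythoff_P (a - t, b - t)"
    | "t \<le> b" "b \<le> a" "wythoff_P (b - t, a - t)"
    by (metis nle_le wythoff_P_swap)
  then show ?thesis
  proof cases
    case 1
    then show ?thesis using single[of t First] \<open>0 < t\<close> p by simp
  next
    case 2
    then show ?thesis using single[of t Second] \<open>0 < t\<close> p by simp
  next
    case 3
    then show ?thesis using diagonal[of First Second t] \<open>0 < t\<close> p by simp
  next
    case 4
    then show ?thesis using diagonal[of Second First t] \<open>0 < t\<close> p by simp
  qed
qed

lemma imitation_move_decreasing: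
  assumes "imitation_move h h'"
  shows "fst (current h') + snd (current h') < fst (current h) + snd (current h)"
proof -
  obtain i x where "legal_move h (i, x)" "h' = After h (i, x)"
    using assms by (auto simp: imitation_move_def)
  then show ?thesis
    by (cases i; cases "current h") auto
qed

theorem prev_wins_imitation_iff_good:
  assumes "legal_history h"
  shows "prev_wins imitation_move h \<longleftrightarrow> good h"
proof (rule prev_wins_iff_kernel[where f = "\<lambda>h. fst (current h) + snd (current h)"
      and I = legal_history])
  show "fst (current t) + snd (current t) < fst (current s) + snd (current s)"
    if "imitation_move s t" for s t
    using that by (rule imitation_move_decreasing)
  show "legal_history t" if "legal_history s" "imitation_move s t" for s t
    using that by (auto simp: imitation_move_def intro: legal_history.intros)
  show "\<not> good t" if "legal_history s" "good s" "imitation_move s t" for s t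
    using that good_stable by (auto simp: imitation_move_def)
  show "\<exists>t. imitation_move s t \<and> good t" if "legal_history s" "\<not> good s" for s
    using good_absorbing[OF that] by (auto simp: imitation_move_def)
qed (fact assms)

lemma next_wins_imitation_iff_not_good:
  assumes "legal_history h"
  shows "next_wins imitation_move h \<longleftrightarrow> \<not> good h"
  using prev_wins_imitation_iff_good[OF assms]
    next_wins_iff_not_prev_wins[of imitation_move "\<lambda>h. fst (current h) + snd (current h)",
      OF imitation_move_decreasing]
  by simp

section \<open>Dynamic and non-dynamic positions\<close>

lemma nondynamic_P_iff: "nondynamic_P p \<longleftrightarrow> wythoff_P p"
proof
  assume "nondynamic_P p"
  moreover have "legal_history (Start p)"
    by (rule legal_history.intros)
  ultimately have "good (Start p)"
    by (auto simp: nondynamic_P_def prev_wins_imitation_iff_good)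
  then show "wythoff_P p"
    by (simp add: good_def)
next
  assume "wythoff_P p"
  then show "nondynamic_P p"
    by (auto simp: nondynamic_P_def prev_wins_imitation_iff_good good_def)
qed

text \<open>Every removal from the larger pile that leaves it at least as high as the other one is banned
  by some history: the previous player took the same number of tokens from the lower pile.\<close>

lemma nondynamic_N_iff:
  assumes "a \<le> b"
  shows "nondynamic_N (a, b) \<longleftrightarrow> (\<forall>d. a \<le> d \<and> d \<le> b \<longrightarrow> \<not> wythoff_P (a, d))"
proof
  assume N: "nondynamic_N (a, b)"
  have not_good: "\<not> good h" if "legal_history h" "current h = (a, b)" for h
    using N that by (auto simp: nondynamic_N_def next_wins_imitation_iff_not_good)
  show "\<forall>d. a \<le> d \<and> d \<le> b \<longrightarrow> \<not> wythoff_P (a, d)"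
  proof (intro allI impI)
    fix d
    assume d: "a \<le> d \<and> d \<le> b"
    show "\<not> wythoff_P (a, d)"
    proof (cases "d = b")
      case True
      then show ?thesis
        using not_good[of "Start (a, b)"] legal_history.intros by (auto simp: good_def)
    next
      case False
      define x where "x = b - d"
      let ?h = "After (Start (a + x, b)) (First, x)"
      have "legal_history ?h"
        using False d by (intro legal_history.intros) (auto simp: x_def)
      then have "\<not> good ?h"
        by (rule not_good) simp
      moreover have "a + x \<le> b" "b - x = d"
        using d by (auto simp: x_def)
      ultimately show ?thesis
        using good_After_iff[of First Second "Start (a + x, b)" x] by simp
    qed
  qed
next
  assume no_P: "\<forall>d. a \<le> d \<and> d \<le> b \<longrightarrow> \<not> wythoff_P (a, d)"
  have "\<not> good h" if h: "legal_history h" "current h = (a, b)" for h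
  proof
    assume "good h"
    moreover have "\<not> wythoff_P (a, b)"
      using no_P assms by blast
    ultimately obtain j x where banned: "imitates h (j, x)" "wythoff_P (remove_tokens (j, x) (a, b))"
      using h(2) by (auto simp: good_def)
    show False
    proof (cases j)
      case First
      then show False
        using imitates_heights[OF h(1), of First x Second] banned h(2) assms by simp
    next
      case Second
      then have "a + x \<le> b" "wythoff_P (a, b - x)"
        using imitates_heights[OF h(1), of Second x First] banned h(2) by simp_all
      then show False
        using no_P by auto
    qed
  qed
  then show "nondynamic_N (a, b)"
    by (simp add: nondynamic_N_def next_wins_imitation_iff_not_good)
qed

theorem proposition0:
  fixes a b :: nat
  assumes "a \<le> b"
  shows "(nondynamic_P (a, b) \<longleftrightarrow> wythoff_P (a, b)) \<and>
    (nondynamic_N (a, b) \<longleftrightarrow>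
       (\<exists>c d. c \<le> d \<and> d < b \<and> b - a = d - c \<and> wythoff_P (c, d)) \<or>
       (\<exists>c. c < a \<and> wythoff_P (a, c)))"
proof (intro conjI nondynamic_P_iff iffI)
  assume "nondynamic_N (a, b)"
  then have no_P: "\<not> wythoff_P (a, d)" if "a \<le> d" "d \<le> b" for d
    using that nondynamic_N_iff[OF assms] by blast
  have "\<not> wythoff_P (a, b)"
    using no_P assms by blast
  then obtain t where t: "0 < t" and option:
    "t \<le> a \<and> wythoff_P (a - t, b) \<or> t \<le> b \<and> wythoff_P (a, b - t) \<or>
     t \<le> a \<and> t \<le> b \<and> wythoff_P (a - t, b - t)"
    using wythoff_P_iff[of a b] by blast
  then consider (smaller) "t \<le> a" "wythoff_P (a - t, b)" | (larger) "wythoff_P (a, b - t)"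
    | (both) "t \<le> a" "wythoff_P (a - t, b - t)"
    by blast
  then show "(\<exists>c d. c \<le> d \<and> d < b \<and> b - a = d - c \<and> wythoff_P (c, d)) \<or>
    (\<exists>c. c < a \<and> wythoff_P (a, c))"
  proof cases
    case smaller
    (* The difference b - a is below that of (a - t, b), so it occurs earlier on the diagonal. *)
    then obtain c where c: "c < a - t" "wythoff_P (c, c + (b - a))"
      using smaller_difference_occurs[of "a - t" b "b - a"] t assms by auto
    then have "c \<le> c + (b - a)" "c + (b - a) < b" "b - a = c + (b - a) - c"
      using assms by auto
    then show ?thesis
      using c(2) by blast
  next
    case larger
    then have "b - t < a"
      using no_P[of "b - t"] by force
    then show ?thesis
      using larger by blast
  next
    case both
    have "a - t \<le> b - t" "b - t < b" "b - a = (b - t) - (a - t)"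
      using both(1) t assms by auto
    then show ?thesis
      using both(2) by blast
  qed
next
  assume "(\<exists>c d. c \<le> d \<and> d < b \<and> b - a = d - c \<and> wythoff_P (c, d)) \<or>
    (\<exists>c. c < a \<and> wythoff_P (a, c))"
  then have "\<not> wythoff_P (a, d)" if d: "a \<le> d" "d \<le> b" for d
  proof
    assume "\<exists>c d. c \<le> d \<and> d < b \<and> b - a = d - c \<and> wythoff_P (c, d)"
    then obtain c e where "c \<le> e" "e < b" "b - a = e - c" "wythoff_P (c, e)"
      by blast
    moreover from this have "c < a" "d - a \<le> e - c"
      using assms d by linarith+
    ultimately show ?thesis
      using wythoff_P_closer_below[of c e a d] d by blast
  next
    assume "\<exists>c. c < a \<and> wythoff_P (a, c)"
    then show ?thesis
      using wythoff_P_row_unique[of a d] d by auto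
  qed
  then show "nondynamic_N (a, b)"
    using nondynamic_N_iff[OF assms] by blast
qed

end
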